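(* Let $n\ge 2$ be an integer. Every graph $G\in\overline G_{n,n-1}$ is traceable.
   Context: All graphs are finite and simple. For positive integers $m,n$, $G_{m,n}$ denotes the class of all simple graphs that have the same degree sequence as the disjoint union $K_m\cup K_n$ of two cliques but are not isomorphic to $K_m\cup K_n$. $\overline G_{m,n}$ denotes the class of complements of graphs in $G_{m,n}$; equivalently, the graphs on $m+n$ vertices with $n$ vertices of degree $m$ and $m$ further vertices of degree $n$ that are not isomorphic to the complete bipartite graph $K_{m,n}$. A graph is traceable if it contains a Hamiltonian path, i.e. a path visiting every vertex exactly once. *)

theory Defs
  imports "Graph_Theory.Graph_Theory" "HOL-Library.Multiset"
begin

text \<open>
  Finite simple graphs are the symmetric loop-free digraphs of locale \<^locale>\<open>pair_graph\<close>:
  an edge is the pair of its two opposite arcs, so the degree of a vertex is its out-degree.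
\<close>

definition complete_graph_on :: "'a set \<Rightarrow> 'a pair_pre_digraph" where
  "complete_graph_on S = \<lparr>pverts = S, parcs = {(u, v). u \<in> S \<and> v \<in> S \<and> u \<noteq> v}\<rparr>"

definition graph_disjoint_union ::
    "'a pair_pre_digraph \<Rightarrow> 'b pair_pre_digraph \<Rightarrow> ('a + 'b) pair_pre_digraph" where
  "graph_disjoint_union G H =
     \<lparr>pverts = pverts G <+> pverts H,
      parcs = map_prod Inl Inl ` parcs G \<union> map_prod Inr Inr ` parcs H\<rparr>"

definition graph_complement :: "'a pair_pre_digraph \<Rightarrow> 'a pair_pre_digraph" where
  "graph_complement G =
     \<lparr>pverts = pverts G,
      parcs = {(u, v). u \<in> pverts G \<and> v \<in> pverts G \<and> u \<noteq> v \<and> (u, v) \<notin> parcs G}\<rparr>"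

definition two_cliques :: "nat \<Rightarrow> nat \<Rightarrow> (nat + nat) pair_pre_digraph" where
  "two_cliques m n =
     graph_disjoint_union (complete_graph_on {..<m}) (complete_graph_on {..<n})"

text \<open>The degrees of all vertices, with repetitions, in non-increasing order.\<close>

definition degree_sequence :: "'a pair_pre_digraph \<Rightarrow> nat list" where
  "degree_sequence G =
     rev (sorted_list_of_multiset
       (image_mset (out_degree (with_proj G)) (mset_set (pverts G))))"

definition G_class :: "nat \<Rightarrow> nat \<Rightarrow> 'a pair_pre_digraph set" where
  "G_class m n =
     {G. pair_graph G \<and>
         degree_sequence G = degree_sequence (two_cliques m n) \<and>
         \<not> digraph_iso (with_proj G) (with_proj (two_cliques m n))}"

definition co_G_class :: "nat \<Rightarrow> nat \<Rightarrow> 'a pair_pre_digraph set" where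
  "co_G_class m n = graph_complement ` G_class m n"

definition traceable :: "'a pair_pre_digraph \<Rightarrow> bool" where
  "traceable G \<longleftrightarrow> (\<exists>p. vpath p (with_proj G) \<and> set p = pverts G)"

lemma complete_digraph_complete_graph_on:
  "finite S \<Longrightarrow> complete_digraph (card S) (with_proj (complete_graph_on S))"
  by (auto simp: complete_digraph_pair_def complete_graph_on_def)

lemma pair_graph_graph_complement:
  assumes "pair_graph G"
  shows "pair_graph (graph_complement G)"
proof -
  interpret pair_graph G by fact
  have "parcs (graph_complement G) \<subseteq> pverts G \<times> pverts G"
    by (auto simp: graph_complement_def)
  then have fin: "finite (parcs (graph_complement G))"
    by (rule finite_subset) (simp add: pair_finite_verts)
  have "sym (parcs G)"
    using pair_sym_arcs by (simp add: symmetric_def)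
  then have "sym (parcs (graph_complement G))"
    by (auto simp: graph_complement_def sym_def)
  then have sym: "symmetric (with_proj (graph_complement G))"
    by (simp add: symmetric_def)
  show ?thesis
    by unfold_locales (use fin sym in \<open>auto simp: graph_complement_def pair_finite_verts\<close>)
qed

lemma pair_graph_two_cliques: "pair_graph (two_cliques m n)"
proof -
  have sym: "symmetric (with_proj (two_cliques m n))"
    by (auto simp: symmetric_def sym_def two_cliques_def graph_disjoint_union_def
        complete_graph_on_def)
  have "parcs (two_cliques m n) \<subseteq> pverts (two_cliques m n) \<times> pverts (two_cliques m n)"
    by (auto simp: two_cliques_def graph_disjoint_union_def complete_graph_on_def)
  moreover have fv: "finite (pverts (two_cliques m n))"
    by (simp add: two_cliques_def graph_disjoint_union_def complete_graph_on_def)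
  ultimately have fa: "finite (parcs (two_cliques m n))"
    by (meson finite_SigmaI finite_subset)
  show ?thesis
    by unfold_locales (use fv fa sym in \<open>auto simp: two_cliques_def graph_disjoint_union_def
        complete_graph_on_def\<close>)
qed

end

theory Submission
  imports Defs
begin

text \<open>
  A graph in the class has \<open>N = 2n - 1\<close> vertices, and all its degrees are at least
  \<open>n - 1 = (N - 1) / 2\<close>. This is exactly the threshold of the Hamiltonian path version of
  Dirac's theorem (\<open>dirac_hamiltonian_path\<close>), so the degrees alone force traceability.

  To prove that version, take a path \<open>p\<close> of maximal length and suppose that it misses a
  vertex \<open>u\<close>. By maximality all neighbours of the two ends of \<open>p\<close> lie on \<open>p\<close>, and since \<open>p\<close> has at
  most \<open>N - 1\<close> vertices, a pigeonhole argument (\<open>path_crossing_edges\<close>) gives consecutive vertices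
  \<open>x\<close>, \<open>y\<close> of \<open>p\<close> such that the first vertex is adjacent to \<open>y\<close> and the last one to \<open>x\<close>. Exchanging
  the edge \<open>xy\<close> for these two edges makes a cycle on the vertices of \<open>p\<close>. Also \<open>u\<close> has a neighbour
  on \<open>p\<close>: otherwise the neighbourhoods of \<open>u\<close> and of the first vertex of \<open>p\<close>, together with these
  two vertices themselves, would be disjoint and contain \<open>N + 1\<close> vertices. Starting at \<open>u\<close> and
  going once around the cycle yields a path longer than \<open>p\<close>.
\<close>

section \<open>Dirac's theorem for Hamiltonian paths\<close>

text \<open>
  Each neighbour of the first vertex marks the edge of the path that enters it, and each neighbour
  of the last vertex marks the edge that leaves it. There are only \<open>length p - 1\<close> edges, so some
  edge is marked twice; the path is cut there.
\<close>

lemma path_crossing_edges: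
  assumes dist: "distinct p"
    and irrefl: "\<And>x. \<not> E x x"
    and ne: "p \<noteq> []"
    and first: "{x. E (hd p) x} \<subseteq> set p"
    and last: "{x. E (last p) x} \<subseteq> set p"
    and deg: "length p \<le> card {x. E (hd p) x} + card {x. E (last p) x}"
  obtains xs ys where "p = xs @ ys" "xs \<noteq> []" "ys \<noteq> []" "E (hd p) (hd ys)" "E (last p) (last xs)"
proof -
  define k where "k = length p - 1"
  have k: "length p = Suc k"
    using ne by (simp add: k_def)
  have hd: "hd p = p ! 0" and lst: "last p = p ! k"
    using ne k by (simp_all add: hd_conv_nth last_conv_nth)
  define A where "A = {i. i < k \<and> E (hd p) (p ! Suc i)}"
  define B where "B = {i. i < k \<and> E (last p) (p ! i)}"
  have fin: "finite A" "finite B"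
    by (simp_all add: A_def B_def)
  have "{x. E (hd p) x} \<subseteq> (\<lambda>i. p ! Suc i) ` A"
  proof
    fix x assume "x \<in> {x. E (hd p) x}"
    then have x: "E (hd p) x" "x \<in> set p" using first by auto
    then obtain j where j: "j < Suc k" "x = p ! j"
      by (metis in_set_conv_nth k)
    moreover have "j \<noteq> 0" using x j hd irrefl by metis
    ultimately show "x \<in> (\<lambda>i. p ! Suc i) ` A"
      using x by (cases j) (auto simp: A_def)
  qed
  then have cA: "card {x. E (hd p) x} \<le> card A"
    using fin surj_card_le by blast
  have "{x. E (last p) x} \<subseteq> (\<lambda>i. p ! i) ` B"
  proof
    fix x assume "x \<in> {x. E (last p) x}"
    then have x: "E (last p) x" "x \<in> set p" using last by auto
    then obtain j where j: "j < Suc k" "x = p ! j"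
      by (metis in_set_conv_nth k)
    moreover have "j \<noteq> k" using x j lst irrefl by metis
    ultimately show "x \<in> (\<lambda>i. p ! i) ` B"
      using x by (auto simp: B_def)
  qed
  then have cB: "card {x. E (last p) x} \<le> card B"
    using fin surj_card_le by blast
  have "A \<inter> B \<noteq> {}"
  proof
    assume "A \<inter> B = {}"
    then have "card (A \<union> B) = card A + card B"
      using fin by (simp add: card_Un_disjoint)
    moreover have "card (A \<union> B) \<le> card {..<k}"
      by (rule card_mono) (auto simp: A_def B_def)
    ultimately show False using cA cB deg k by simp
  qed
  then obtain i where i: "i < k" "E (hd p) (p ! Suc i)" "E (last p) (p ! i)"
    by (auto simp: A_def B_def)
  show ?thesis
  proof
    show "p = take (Suc i) p @ drop (Suc i) p" by simp
    show "take (Suc i) p \<noteq> []" using ne by simp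
    show "drop (Suc i) p \<noteq> []" using i k by simp
    show "E (hd p) (hd (drop (Suc i) p))" using i k by (simp add: hd_drop_conv_nth)
    show "E (last p) (last (take (Suc i) p))"
      using i k by (simp add: take_Suc_conv_app_nth)
  qed
qed

text \<open>
  A longest path that is not spanning has all neighbours of its ends on it and closes up to a
  cycle on the same vertices; a vertex off the cycle with a neighbour on it then gives a longer
  path.
\<close>

lemma dirac_hamiltonian_path:
  assumes fin: "finite V" and ne: "V \<noteq> {}"
    and wf: "\<And>x y. E x y \<Longrightarrow> y \<in> V"
    and irrefl: "\<And>x. \<not> E x x"
    and sym: "symp E"
    and deg: "\<And>v. v \<in> V \<Longrightarrow> card V \<le> 2 * card {x. E v x} + 1"
  obtains p where "distinct p" "set p = V" "successively E p"
proof -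
  define P where "P = (\<lambda>p. p \<noteq> [] \<and> distinct p \<and> set p \<subseteq> V \<and> successively E p)"
  have bound: "length p < Suc (card V)" if "P p" for p
    using that fin by (metis P_def card_mono distinct_card less_Suc_eq_le)
  have symD: "E y x" if "E x y" for x y
    using that sym by (rule sympD[rotated])
  obtain v where "v \<in> V" using ne by blast
  then have "P [v]" by (simp add: P_def)
  then obtain p where p: "P p" and max: "\<And>q. P q \<Longrightarrow> length q \<le> length p"
    using ex_has_greatest_nat[of P "[v]" length "Suc (card V)"] bound less_imp_le by metis
  have pne: "p \<noteq> []" and dist: "distinct p" and sub: "set p \<subseteq> V" and path: "successively E p"
    using p by (simp_all add: P_def)
  have len: "length p = card (set p)"
    using dist by (simp add: distinct_card)
  have "set p = V"
  proof (rule ccontr)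
    assume "set p \<noteq> V"
    then obtain u where u: "u \<in> V" "u \<notin> set p" using sub by blast
    have less: "length p < card V"
      using len sub \<open>set p \<noteq> V\<close> fin by (simp add: psubset_card_mono psubset_eq)
    have first: "{x. E (hd p) x} \<subseteq> set p"
    proof
      fix x assume x: "x \<in> {x. E (hd p) x}"
      show "x \<in> set p"
      proof (rule ccontr)
        assume "x \<notin> set p"
        then have "P (x # p)"
          using x wf symD p by (auto simp: P_def successively_Cons)
        then show False using max by force
      qed
    qed
    have last: "{x. E (last p) x} \<subseteq> set p"
    proof
      fix x assume x: "x \<in> {x. E (last p) x}"
      show "x \<in> set p"
      proof (rule ccontr)
        assume "x \<notin> set p"
        then have "P (p @ [x])"
          using x wf p by (auto simp: P_def successively_append_iff)
        then show False using max by force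
      qed
    qed
    have ends: "hd p \<in> V" "last p \<in> V" using pne sub by auto
    have "length p \<le> card {x. E (hd p) x} + card {x. E (last p) x}"
      using deg[OF ends(1)] deg[OF ends(2)] less by linarith
    then obtain xs ys where split: "p = xs @ ys" "xs \<noteq> []" "ys \<noteq> []"
        "E (hd p) (hd ys)" "E (last p) (last xs)"
      using path_crossing_edges[OF dist irrefl pne first last] by blast
    \<comment> \<open>Read cyclically, this list is a cycle: its edges from \<open>xs\<close> to \<open>rev ys\<close> and back are
      the two adjacencies of the ends of \<open>p\<close> from \<open>split\<close>.\<close>
    define c where "c = xs @ rev ys"
    have c: "distinct c" "set c = set p" "length c = length p"
      using dist by (auto simp: c_def split)
    have "successively E (rev ys)"
      using path symD by (auto simp: split successively_append_iff intro: successively_mono)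
    then have c_path: "successively E c" and c_closed: "E (last c) (hd c)"
      using path split symD by (auto simp: c_def successively_append_iff hd_rev last_rev)
    have "\<exists>w\<in>set p. E u w"
    proof (rule ccontr)
      assume none: "\<not> (\<exists>w\<in>set p. E u w)"
      then have "insert u {x. E u x} \<subseteq> V - set p"
        using u wf by auto
      then have "card (insert u {x. E u x}) \<le> card V - card (set p)"
        using fin sub by (metis List.finite_set card_Diff_subset card_mono finite_Diff)
      moreover have "card (insert (hd p) {x. E (hd p) x}) \<le> card (set p)"
        using first pne by (intro card_mono) auto
      moreover have "finite {x. E z x}" for z
        using wf fin by (auto intro: finite_subset)
      ultimately have "Suc (card {x. E u x}) + Suc (card {x. E (hd p) x}) \<le> card V"
        using irrefl less len by simp
      then show False using deg[OF u(1)] deg[OF ends(1)] by linarith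
    qed
    then obtain w where w: "w \<in> set c" "E u w" using c by auto
    then obtain as bs where ab: "c = as @ w # bs" by (meson split_list)
    \<comment> \<open>The cycle is entered at \<open>w\<close>; the closing edge joins its end to \<open>as\<close>.\<close>
    have "successively E (u # w # bs @ as)"
      using c_path c_closed w
      by (cases "as = []"; cases "bs = []") (auto simp: ab successively_append_iff successively_Cons)
    moreover have "distinct (u # w # bs @ as)" "set (u # w # bs @ as) \<subseteq> V"
      using c u sub by (auto simp: ab)
    ultimately have "P (u # w # bs @ as)" by (simp add: P_def)
    then have "length (u # w # bs @ as) \<le> length p" by (rule max)
    then show False using c(3) by (simp add: ab)
  qed
  then show thesis using that dist path by blast
qed

section \<open>From out-degrees of digraphs to traceability\<close>

lemma out_degree_with_proj:
  "out_degree (with_proj G) v = card {w. (v, w) \<in> parcs G}"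
proof -
  have "out_arcs (with_proj G) v = Pair v ` {w. (v, w) \<in> parcs G}"
    by (auto simp: out_arcs_def)
  then show ?thesis
    by (simp add: out_degree_def card_image inj_on_def)
qed

lemma vwalk_with_proj_iff_successively:
  "vwalk p (with_proj G) \<longleftrightarrow>
     p \<noteq> [] \<and> set p \<subseteq> pverts G \<and> successively (\<lambda>x y. (x, y) \<in> parcs G) p"
proof -
  have "set (vwalk_arcs p) \<subseteq> parcs G \<longleftrightarrow> successively (\<lambda>x y. (x, y) \<in> parcs G) p"
    by (induction p rule: vwalk_arcs.induct) auto
  then show ?thesis by (auto simp: vwalk_def)
qed

lemma traceable_if_min_degree:
  assumes "pair_graph G" and ne: "pverts G \<noteq> {}"
    and deg: "\<And>v. v \<in> pverts G \<Longrightarrow> card (pverts G) \<le> 2 * out_degree (with_proj G) v + 1"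
  shows "traceable G"
proof -
  interpret pair_graph G by fact
  let ?E = "\<lambda>x y. (x, y) \<in> parcs G"
  have "symp ?E"
    using pair_sym_arcs by (auto simp: symmetric_def sym_def symp_def)
  then obtain p where "distinct p" "set p = pverts G" "successively ?E p"
  proof (rule dirac_hamiltonian_path[rotated 4])
    show "card (pverts G) \<le> 2 * card {w. (v, w) \<in> parcs G} + 1" if "v \<in> pverts G" for v
      using deg[OF that] by (simp add: out_degree_with_proj)
  qed (use ne pair_finite_verts in_arcsD2 pair_no_loops in \<open>fastforce+\<close>)
  moreover from this ne have "p \<noteq> []" by auto
  ultimately show ?thesis
    by (auto simp: traceable_def vpath_def vwalk_with_proj_iff_successively)
qed

section \<open>Degrees in the complements\<close>

lemma out_degree_graph_complement:
  assumes "pair_graph G" and v: "v \<in> pverts G"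
  shows "out_degree (with_proj (graph_complement G)) v =
    card (pverts G) - 1 - out_degree (with_proj G) v"
proof -
  interpret pair_graph G by fact
  let ?N = "{w. (v, w) \<in> parcs G}"
  have "{w. (v, w) \<in> parcs (graph_complement G)} = pverts G - {v} - ?N"
    using v by (auto simp: graph_complement_def)
  moreover have "?N \<subseteq> pverts G - {v}"
    using in_arcsD2 pair_no_loops by fastforce
  moreover from this have "finite ?N"
    using pair_finite_verts finite_subset by blast
  ultimately show ?thesis
    using v by (simp add: out_degree_with_proj card_Diff_subset pair_finite_verts)
qed

lemma image_mset_out_degree_eq_if_degree_sequence_eq:
  assumes "degree_sequence G = degree_sequence H"
  shows "image_mset (out_degree (with_proj G)) (mset_set (pverts G)) =
    image_mset (out_degree (with_proj H)) (mset_set (pverts H))"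
  using arg_cong[OF assms, of mset] by (simp add: degree_sequence_def)

lemma pverts_two_cliques: "pverts (two_cliques m n) = {..<m} <+> {..<n}"
  by (simp add: two_cliques_def graph_disjoint_union_def complete_graph_on_def)

lemma out_degree_two_cliques_le:
  assumes "v \<in> pverts (two_cliques m n)"
  shows "out_degree (with_proj (two_cliques m n)) v \<le> max m n - 1"
proof -
  have "{w. (v, w) \<in> parcs (two_cliques m n)} \<subseteq>
      (case v of Inl i \<Rightarrow> Inl ` ({..<m} - {i}) | Inr i \<Rightarrow> Inr ` ({..<n} - {i}))" (is "_ \<subseteq> ?C")
    by (auto simp: two_cliques_def graph_disjoint_union_def complete_graph_on_def
        split: sum.splits)
  moreover have "finite ?C"
    by (auto split: sum.splits)
  ultimately have "out_degree (with_proj (two_cliques m n)) v \<le> card ?C"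
    by (simp add: out_degree_with_proj card_mono)
  also have "\<dots> \<le> max m n - 1"
    using assms by (auto simp: pverts_two_cliques card_image split: sum.splits)
  finally show ?thesis .
qed

lemma G_class_card_pverts:
  assumes "G \<in> G_class m n"
  shows "card (pverts G) = m + n"
proof -
  have "image_mset (out_degree (with_proj G)) (mset_set (pverts G)) =
      image_mset (out_degree (with_proj (two_cliques m n))) (mset_set (pverts (two_cliques m n)))"
    using assms by (intro image_mset_out_degree_eq_if_degree_sequence_eq) (simp add: G_class_def)
  from arg_cong[OF this, of size] show ?thesis
    by (simp add: pverts_two_cliques card_Plus)
qed

lemma G_class_out_degree_le:
  assumes "G \<in> G_class m n" and v: "v \<in> pverts G"
  shows "out_degree (with_proj G) v \<le> max m n - 1"
proof -
  have eq: "image_mset (out_degree (with_proj G)) (mset_set (pverts G)) =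
      image_mset (out_degree (with_proj (two_cliques m n))) (mset_set (pverts (two_cliques m n)))"
    using assms by (intro image_mset_out_degree_eq_if_degree_sequence_eq) (simp add: G_class_def)
  interpret pair_graph G
    using assms by (simp add: G_class_def)
  have "out_degree (with_proj G) ` pverts G =
      out_degree (with_proj (two_cliques m n)) ` pverts (two_cliques m n)"
    using arg_cong[OF eq, of set_mset] pair_finite_verts by (simp add: pverts_two_cliques)
  then show ?thesis
    using v out_degree_two_cliques_le by (metis (no_types, lifting) imageE imageI)
qed

theorem proposition8:
  fixes n :: nat and G :: "'a pair_pre_digraph"
  assumes "n \<ge> 2"
    and "G \<in> co_G_class n (n - 1)"
  shows "traceable G"
proof -
  obtain H where H: "H \<in> G_class n (n - 1)" and G: "G = graph_complement H"
    using assms(2) by (auto simp: co_G_class_def)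
  have graph: "pair_graph H"
    using H by (simp add: G_class_def)
  have verts: "pverts G = pverts H"
    by (simp add: G graph_complement_def)
  have card: "card (pverts G) = 2 * n - 1"
    using G_class_card_pverts[OF H] assms(1) verts by simp
  show ?thesis
  proof (rule traceable_if_min_degree)
    show "pair_graph G"
      using graph by (simp add: G pair_graph_graph_complement)
    show "pverts G \<noteq> {}"
      using card assms(1) by auto
    fix v assume "v \<in> pverts G"
    then have v: "v \<in> pverts H" by (simp add: verts)
    have "out_degree (with_proj G) v = 2 * n - 2 - out_degree (with_proj H) v"
      using out_degree_graph_complement[OF graph v] card verts by (simp add: G)
    moreover have "out_degree (with_proj H) v \<le> n - 1"
      using G_class_out_degree_le[OF H v] by simp
    ultimately show "card (pverts G) \<le> 2 * out_degree (with_proj G) v + 1"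
      using card by linarith
  qed
qed

end
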